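(* Let $k\in\mathbb{N}\setminus\{0\}$. For every open set $\Omega\subseteq\mathbb{R}^2$ that is multiply connected of order $k$ and has finite inradius $r_\Omega$, we have \[ h(\Omega)\ \ge\ \frac{\Theta_{1,1}}{\sqrt k}\,\frac{1}{r_\Omega}, \] where $\Theta_{1,1}>0$ is the explicit universal constant given in the context.
   Context: For an open set $\Omega\subseteq\mathbb{R}^2$: the inradius is $r_\Omega=\sup\{r>0 : \text{there exists a disk } B_r(x_0)\subseteq\Omega\}$; the Cheeger constant is \[ h(\Omega)=\inf\left\{\frac{\mathcal{H}^{1}(\partial E)}{|E|} : E\Subset\Omega \text{ has a smooth boundary}\right\}, \] where $E$ ranges over nonempty open sets compactly contained in $\Omega$ with smooth boundary, $\mathcal{H}^1$ is the one-dimensional Hausdorff measure and $|\cdot|$ is Lebesgue measure. Let $(\mathbb{R}^2)^*$ be the one-point compactification of $\mathbb{R}^2$. An open connected set $\Omega\subseteq\mathbb{R}^2$ is multiply connected of order $k$ if its complement in $(\mathbb{R}^2)^*$ has exactly $k$ connected components. The constant is \[ \Theta_{1,1}=\frac{\mathscr{C}}{2\cdot 10^{2}},\qquad \mathscr{C}=\frac{1}{4\cdot 6^{7}\cdot 2^{7}}\left(\frac12\right)^{10}\left[\pi+\frac{4\pi}{1-\frac{\sqrt2}{2}}\,\frac{1}{\mu_{1,1}(B_1)}\right]^{-1}, \] where $B_1\subseteq\mathbb{R}^2$ is the open unit disk centered at the origin and \[ \mu_{1,1}(B_1)=\inf\left\{\frac{\|\nabla u\|_{L^1(B_1)}}{\min_{t\in\mathbb{R}}\|u-t\|_{L^1(B_1)}}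 : u\in\mathrm{Lip}(\overline{B_1})\text{ not constant}\right\}>0 . \] *)

theory Defs
  imports "HOL-Analysis.Analysis"
begin

text \<open>The countable sum is unordered and takes values in \<open>[0, \<infinity>]\<close>. Boundedness of the
  covering sets is required because \<^const>\<open>diameter\<close> is unspecified on unbounded sets; finite
  covers are included by padding with the empty set. In dimension one the normalising
  factor of Hausdorff measure equals 1, so that a segment has its length as measure.\<close>

definition hausdorff_pre1 :: "real \<Rightarrow> 'a::metric_space set \<Rightarrow> ennreal" where
  "hausdorff_pre1 \<delta> A =
     (INF C \<in> {C :: nat \<Rightarrow> 'a set. A \<subseteq> (\<Union>i. C i) \<and> (\<forall>i. bounded (C i) \<and> diameter (C i) \<le> \<delta>)}.
        (\<Sum>i. ennreal (diameter (C i))))"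

definition hausdorff1 :: "'a::metric_space set \<Rightarrow> ennreal" where
  "hausdorff1 A = (SUP \<delta> \<in> {0<..}. hausdorff_pre1 \<delta> A)"

definition smooth_real :: "(real \<Rightarrow> real) \<Rightarrow> bool" where
  "smooth_real \<gamma> \<longleftrightarrow> (\<forall>n x. (deriv ^^ n) \<gamma> differentiable (at x))"

text \<open>Near each boundary point, after a rotation or reflection of the coordinate axes (given
  by the orthonormal basis \<open>u, v\<close>), the set is the strict epigraph of a \<open>C\<^sup>\<infinity>\<close> function.\<close>

definition smooth_boundary :: "(real^2) set \<Rightarrow> bool" where
  "smooth_boundary E \<longleftrightarrow>
     (\<forall>p \<in> frontier E. \<exists>r > 0. \<exists>u v \<gamma>.
        norm u = 1 \<and> norm v = 1 \<and> u \<bullet> v = 0 \<and> smooth_real \<gamma> \<and>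
        E \<inter> ball p r = {x \<in> ball p r. \<gamma> (x \<bullet> u) < x \<bullet> v})"

text \<open>The inradius and the Cheeger constant are extended nonnegative reals: the supremum of the
  empty set is 0 and the infimum of the empty set is \<open>\<infinity>\<close>.\<close>

definition inradius :: "(real^2) set \<Rightarrow> ennreal" where
  "inradius \<Omega> = (SUP r \<in> {r :: real. r > 0 \<and> (\<exists>x. ball x r \<subseteq> \<Omega>)}. ennreal r)"

definition cheeger :: "(real^2) set \<Rightarrow> ennreal" where
  "cheeger \<Omega> =
     (INF E \<in> {E. open E \<and> E \<noteq> {} \<and> compact (closure E) \<and> closure E \<subseteq> \<Omega> \<and> smooth_boundary E}.
        hausdorff1 (frontier E) / emeasure lborel E)"

definition multiply_connected_of_order :: "nat \<Rightarrow> (real^2) set \<Rightarrow> bool" where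
  "multiply_connected_of_order k \<Omega> \<longleftrightarrow>
     open \<Omega> \<and> connected \<Omega> \<and>
     (let S = Alexandroff_compactification (euclidean :: (real^2) topology);
          components = connected_components_of (subtopology S (topspace S - Some ` \<Omega>))
      in finite components \<and> card components = k)"

text \<open>A Lipschitz function is differentiable almost everywhere, so the value 0 at the remaining
  points does not affect the \<open>L\<^sup>1\<close> norm of the gradient.\<close>

definition grad :: "('a::real_inner \<Rightarrow> real) \<Rightarrow> 'a \<Rightarrow> 'a" where
  "grad u x = (if u differentiable (at x) then THE D. GDERIV u x :> D else 0)"

text \<open>The minimum over \<open>t\<close> is attained, and is written as an infimum. Functions on the closed disk
  are represented by their arbitrary extensions to the plane; only values on the closed disk
  matter. The constant is known to be positive, so that dividing by it is meaningful.\<close>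

definition mu11_disk :: real where
  "mu11_disk =
     (INF u \<in> {u :: real^2 \<Rightarrow> real. (\<exists>L. L-lipschitz_on (cball 0 1) u) \<and> \<not> u constant_on (cball 0 1)}.
        (LINT x:ball 0 1|lebesgue. norm (grad u x)) /
        (INF t. LINT x:ball 0 1|lebesgue. \<bar>u x - t\<bar>))"

definition C_const :: real where
  "C_const = 1 / (4 * 6 ^ 7 * 2 ^ 7) * (1 / 2) ^ 10 *
     inverse (pi + 4 * pi / (1 - sqrt 2 / 2) * (1 / mu11_disk))"

definition Theta11 :: real where
  "Theta11 = C_const / (2 * 10 ^ 2)"

end

theory Submission
  imports Defs
begin

text \<open>Fix \<open>\<rho>\<close> so large that every disk of radius \<open>\<rho>\<close> meets the
  complement of \<open>\<Omega>\<close>, cut the plane into cells of side \<open>12 \<rho>\<close>, and choose a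
  point of the complement close to the centre of each cell. If the component of the complement through this point
  leaves the disk of radius \<open>10 \<rho>\<close> about it, then every smaller concentric circle meets the
  complement, so that any such circle meeting \<open>E\<close> also meets the boundary of \<open>E\<close>;
  integrating over the radii, the part of \<open>E\<close> in such a good cell has area at most a multiple of
  \<open>\<rho>\<close> times the length of the nearby boundary. The remaining cells belong to pairwise distinct
  components, so there are at most \<open>k\<close> of them. Hence in a cell of side \<open>24 sqrt k
  \<rho>\<close> either at least half of \<open>E\<close> lies in the good small cells, or \<open>E\<close> fills
  at most half of the large cell and the relative isoperimetric inequality applies. All lengths are measured by
  the sum of diameters of one fixed cover of the boundary by small sets, each of which is near at most nine cells;
  so neither additivity of Hausdorff measure nor smoothness of the boundary plays a role. The resulting constant
  is far larger than \<open>Theta11\<close>, whatever the value of \<open>mu11_disk \<ge> 0\<close>.\<close>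

section \<open>Square cells of the plane and the areas of strips and annuli\<close>

definition cell :: "real \<Rightarrow> real^2 \<Rightarrow> int \<times> int" where
  "cell s x = (\<lfloor>x $ 1 / s\<rfloor>, \<lfloor>x $ 2 / s\<rfloor>)"

lemma cell_eq_iff:
  assumes "s > 0"
  shows "cell s x = (i, j) \<longleftrightarrow>
    s * i \<le> x $ 1 \<and> x $ 1 < s * (i + 1) \<and> s * j \<le> x $ 2 \<and> x $ 2 < s * (j + 1)"
  using assms by (auto simp: cell_def floor_eq_iff field_simps)

text \<open>There are only countably many cells, so measurability of a single cell gives it for any
  union of cells, whatever the index set.\<close>

lemma sets_cell_vimage [measurable]: "cell s -` A \<in> sets borel"
proof -
  have [measurable]: "(\<lambda>x::real^2. x $ i) \<in> borel_measurable borel" for i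
    by (intro borel_measurable_continuous_onI continuous_intros)
  have "cell s -` {p} \<in> sets borel" for p
  proof -
    have "cell s -` {p} = {x. \<lfloor>x $ 1 / s\<rfloor> = fst p} \<inter> {x. \<lfloor>x $ 2 / s\<rfloor> = snd p}"
      by (auto simp: cell_def)
    also have "\<dots> \<in> sets borel" by measurable
    finally show ?thesis .
  qed
  moreover have "cell s -` A = (\<Union>p\<in>A. cell s -` {p})" by auto
  ultimately show ?thesis
    by (metis sets.countable_UN'' countable_subset[OF subset_UNIV countableI_type])
qed

lemma emeasure_cbox_vec2:
  fixes a b :: "real^2"
  assumes "a $ 1 \<le> b $ 1" "a $ 2 \<le> b $ 2"
  shows "emeasure lborel (cbox a b) = ennreal ((b $ 1 - a $ 1) * (b $ 2 - a $ 2))"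
    and "emeasure lborel (box a b) = ennreal ((b $ 1 - a $ 1) * (b $ 2 - a $ 2))"
proof -
  have ne: "cbox a b \<noteq> {}"
    using assms by (auto simp: interval_eq_empty_cart not_less forall_2)
  have "measure lborel (cbox a b) = (b $ 1 - a $ 1) * (b $ 2 - a $ 2)"
    by (subst content_cbox_cart[OF ne]) (simp add: UNIV_2)
  then show 1: "emeasure lborel (cbox a b) = ennreal ((b $ 1 - a $ 1) * (b $ 2 - a $ 2))"
    using emeasure_lborel_cbox_finite[of a b] emeasure_eq_ennreal_measure[of lborel "cbox a b"] by simp
  then show "emeasure lborel (box a b) = ennreal ((b $ 1 - a $ 1) * (b $ 2 - a $ 2))"
    by (simp add: emeasure_lborel_box_eq emeasure_lborel_cbox_eq)
qed

text \<open>The half-open square lies between an open and a closed square of the same side, whose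
  areas agree.\<close>

lemma emeasure_cell:
  assumes "s > 0"
  shows "emeasure lborel (cell s -` {p}) = ennreal (s\<^sup>2)"
proof -
  obtain i j where p: "p = (i, j)" by force
  let ?a = "vector [s * i, s * j] :: real^2"
  let ?b = "vector [s * (i + 1), s * (j + 1)] :: real^2"
  have sub: "box ?a ?b \<subseteq> cell s -` {p}" "cell s -` {p} \<subseteq> cbox ?a ?b"
    using assms by (auto simp: p cell_eq_iff mem_box_cart forall_2)
  have le: "?a $ 1 \<le> ?b $ 1" "?a $ 2 \<le> ?b $ 2"
    using assms by (auto simp: algebra_simps)
  have "(?b $ 1 - ?a $ 1) * (?b $ 2 - ?a $ 2) = s\<^sup>2"
    by (simp add: algebra_simps power2_eq_square)
  then have "emeasure lborel (box ?a ?b) = ennreal (s\<^sup>2)" "emeasure lborel (cbox ?a ?b) = ennreal (s\<^sup>2)"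
    by (simp_all only: emeasure_cbox_vec2[OF le])
  moreover have "emeasure lborel (box ?a ?b) \<le> emeasure lborel (cell s -` {p})"
    using sub by (intro emeasure_mono) auto
  moreover have "emeasure lborel (cell s -` {p}) \<le> emeasure lborel (cbox ?a ?b)"
    using sub by (intro emeasure_mono) auto
  ultimately show ?thesis by (auto intro: antisym)
qed

lemma emeasure_strip_le:
  assumes s: "s > 0" and d: "0 \<le> d"
  shows "emeasure lborel (cell s -` {p} \<inter> {x. \<bar>x $ i - c\<bar> \<le> d}) \<le> ennreal (2 * s * d)"
proof -
  obtain m n where p: "p = (m, n)" by force
  have *: "emeasure lborel (cell s -` {p} \<inter> {x. \<bar>x $ i - c\<bar> \<le> d}) \<le> ennreal (2 * s * d)"
    if "cell s -` {p} \<inter> {x. \<bar>x $ i - c\<bar> \<le> d} \<subseteq> cbox a b"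
      and "a $ 1 \<le> b $ 1" "a $ 2 \<le> b $ 2" "(b $ 1 - a $ 1) * (b $ 2 - a $ 2) = 2 * s * d" for a b
  proof -
    have "emeasure lborel (cell s -` {p} \<inter> {x. \<bar>x $ i - c\<bar> \<le> d}) \<le> emeasure lborel (cbox a b)"
      by (rule emeasure_mono[OF that(1)]) auto
    with emeasure_cbox_vec2(1)[OF that(2,3)] that(4) show ?thesis by simp
  qed
  consider "i = 1" | "i = 2" using exhaust_2 by blast
  then show ?thesis
  proof cases
    case 1
    show ?thesis
      by (rule *[of "vector [c - d, s * n]" "vector [c + d, s * (n + 1)]"])
        (use s d in \<open>auto simp: p 1 cell_eq_iff mem_box_cart forall_2 algebra_simps\<close>)
  next
    case 2
    show ?thesis
      by (rule *[of "vector [s * m, c - d]" "vector [s * (m + 1), c + d]"])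
        (use s d in \<open>auto simp: p 2 cell_eq_iff mem_box_cart forall_2 algebra_simps\<close>)
  qed
qed

text \<open>For \<open>d \<le> a\<close> the set is a difference of two disks of area exactly
  \<open>4 * pi * a * d\<close>. For \<open>a < d\<close> it lies in the disk of radius
  \<open>a + d\<close>, and \<open>a + d\<close> is at most both \<open>2 * R\<close> and
  \<open>2 * d\<close>.\<close>

lemma emeasure_annulus_le:
  fixes x :: "real^2"
  assumes "0 \<le> a" "a \<le> R" "0 \<le> d" "d \<le> R"
  shows "emeasure lborel {y. \<bar>dist x y - a\<bar> \<le> d} \<le> ennreal (4 * pi * R * d)"
proof (cases "d \<le> a")
  case True
  have "{y. \<bar>dist x y - a\<bar> \<le> d} = cball x (a + d) - ball x (a - d)" by auto
  also have "emeasure lborel \<dots> = emeasure lborel (cball x (a + d)) - emeasure lborel (ball x (a - d))"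
    using assms True by (intro emeasure_Diff) (auto simp: emeasure_ball)
  also have "\<dots> = ennreal (pi * (a + d)\<^sup>2 - pi * (a - d)\<^sup>2)"
    using assms True by (simp add: emeasure_ball emeasure_cball unit_ball_vol_2 ennreal_minus)
  also have "\<dots> \<le> ennreal (4 * pi * R * d)"
  proof (rule ennreal_leI)
    have "pi * (a + d)\<^sup>2 - pi * (a - d)\<^sup>2 = 4 * pi * (a * d)"
      by (simp add: power2_eq_square algebra_simps)
    also have "\<dots> \<le> 4 * pi * (R * d)"
      using assms by (intro mult_left_mono mult_right_mono) auto
    finally show "pi * (a + d)\<^sup>2 - pi * (a - d)\<^sup>2 \<le> 4 * pi * R * d" by simp
  qed
  finally show ?thesis .
next
  case False
  have "emeasure lborel {y. \<bar>dist x y - a\<bar> \<le> d} \<le> emeasure lborel (cball x (a + d))"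
    by (rule emeasure_mono) auto
  also have "\<dots> = ennreal (pi * (a + d)\<^sup>2)"
    using assms by (simp add: emeasure_cball unit_ball_vol_2)
  also have "\<dots> \<le> ennreal (4 * pi * R * d)"
  proof (rule ennreal_leI)
    have "(a + d)\<^sup>2 \<le> (2 * R) * (2 * d)"
      unfolding power2_eq_square using assms False by (intro mult_mono) auto
    then have "pi * (a + d)\<^sup>2 \<le> pi * ((2 * R) * (2 * d))"
      by (intro mult_left_mono) auto
    then show "pi * (a + d)\<^sup>2 \<le> 4 * pi * R * d" by (simp add: ac_simps)
  qed
  finally show ?thesis .
qed

lemma floor_diff_le_1:
  fixes a b :: real
  assumes "\<bar>a - b\<bar> < 1"
  shows "\<bar>\<lfloor>a\<rfloor> - \<lfloor>b\<rfloor>\<bar> \<le> 1"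
proof -
  have "\<lfloor>a\<rfloor> \<le> \<lfloor>b + 1\<rfloor>" "\<lfloor>b\<rfloor> \<le> \<lfloor>a + 1\<rfloor>"
    using assms by (intro floor_mono; simp)+
  then show ?thesis by simp
qed

text \<open>A displacement shorter than \<open>s\<close> changes each cell index by at most one, so
  all these cells lie in the three-by-three block around the cell of \<open>c\<close>.\<close>

lemma card_cells_near:
  assumes s: "s > 0" and near: "\<And>p. p \<in> P \<Longrightarrow> \<exists>y. dist c y < s \<and> cell s y = p"
  shows "card P \<le> 9"
proof -
  obtain i j where ij: "cell s c = (i, j)" by force
  have "P \<subseteq> {i - 1 .. i + 1} \<times> {j - 1 .. j + 1}"
  proof
    fix p assume "p \<in> P"
    then obtain y where y: "dist c y < s" "cell s y = p" using near by blast
    obtain m n where p: "p = (m, n)" by force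
    have comp: "\<bar>c $ l - y $ l\<bar> < s" for l
      using y(1) component_le_norm_cart[of "c - y" l] by (simp add: dist_norm)
    have "\<bar>c $ l / s - y $ l / s\<bar> < 1" for l
      using comp[of l] s by (simp add: diff_divide_distrib[symmetric])
    then have "\<bar>\<lfloor>c $ l / s\<rfloor> - \<lfloor>y $ l / s\<rfloor>\<bar> \<le> 1" for l
      using floor_diff_le_1[of "c $ l / s" "y $ l / s"] by blast
    from this[of 1] this[of 2] show "p \<in> {i - 1 .. i + 1} \<times> {j - 1 .. j + 1}"
      using ij y(2) by (auto simp: p cell_def)
  qed
  then have "card P \<le> card ({i - 1 .. i + 1} \<times> {j - 1 .. j + 1})"
    by (intro card_mono) auto
  then show ?thesis by simp
qed

lemma finite_cell_image:
  assumes "s > 0" "bounded E"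
  shows "finite (cell s ` E)"
proof -
  obtain B where B: "\<And>x. x \<in> E \<Longrightarrow> norm x \<le> B"
    using assms(2) bounded_iff by blast
  have "cell s ` E \<subseteq> {\<lfloor>- B / s\<rfloor>..\<lfloor>B / s\<rfloor>} \<times> {\<lfloor>- B / s\<rfloor>..\<lfloor>B / s\<rfloor>}"
  proof (rule image_subsetI)
    fix x assume x: "x \<in> E"
    have "\<bar>x $ l\<bar> \<le> B" for l
      using B[OF x] component_le_norm_cart[of x l] by simp
    then have "- B / s \<le> x $ l / s" "x $ l / s \<le> B / s" for l
      using assms(1) by (intro divide_right_mono; simp add: abs_le_iff minus_le_iff)+
    then show "cell s x \<in> {\<lfloor>- B / s\<rfloor>..\<lfloor>B / s\<rfloor>} \<times> {\<lfloor>- B / s\<rfloor>..\<lfloor>B / s\<rfloor>}"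
      unfolding cell_def mem_Times_iff fst_conv snd_conv atLeastAtMost_iff
      by (intro conjI floor_mono)
  qed
  then show ?thesis by (rule finite_subset) auto
qed

section \<open>Area bounded by the diameters of a cover of the boundary\<close>

text \<open>After exchanging the sums, each \<open>f i\<close> is counted once for every
  \<open>p\<close> related to \<open>i\<close>. This adds up local estimates without appeal to
  additivity of a measure on the boundary.\<close>

lemma sum_suminf_incidence_le:
  fixes f :: "nat \<Rightarrow> ennreal"
  assumes "finite F" "\<And>i. card {p \<in> F. P p i} \<le> N"
  shows "(\<Sum>p\<in>F. \<Sum>i. if P p i then f i else 0) \<le> of_nat N * (\<Sum>i. f i)"
proof -
  have "(\<Sum>p\<in>F. \<Sum>i. if P p i then f i else 0) = (\<Sum>i. \<Sum>p\<in>F. if P p i then f i else 0)"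
    by (rule suminf_sum[symmetric]) simp
  also have "\<dots> = (\<Sum>i. of_nat (card {p \<in> F. P p i}) * f i)"
    using assms(1) by (simp add: sum.If_cases Int_def)
  also have "\<dots> \<le> (\<Sum>i. of_nat N * f i)"
    using assms(2) by (intro suminf_le mult_right_mono) auto
  finally show ?thesis by simp
qed

lemma frontier_between:
  assumes "connected T" "x \<in> T" "y \<in> T" "x \<in> E" "y \<notin> E"
  obtains u where "u \<in> T" "u \<in> frontier E"
  using connected_Int_frontier[of T E] assms by blast

lemma cell_convex:
  assumes "s > 0" "cell s x = p" "cell s y = p" "u \<in> closed_segment x y"
  shows "cell s u = p"
proof -
  obtain i j where p: "p = (i, j)" by force
  have comp: "u $ l \<in> closed_segment (x $ l) (y $ l)" for l
    using assms(4) by (auto simp: in_segment)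
  show ?thesis
    using comp[of 1] comp[of 2] assms(2,3)
    by (auto simp: p cell_eq_iff[OF assms(1)] closed_segment_eq_real_ivl split: if_splits)
qed

text \<open>The shared last step of the two local estimates below: \<open>V i\<close> is a strip or
  an annulus around one point of the \<open>i\<close>-th cover set, with area linear in the diameter
  \<open>d i\<close>.\<close>

lemma emeasure_le_incidence_suminf:
  assumes cov: "\<And>x. x \<in> A \<Longrightarrow> \<exists>i. P i \<and> x \<in> V i"
    and V: "\<And>i. V i \<in> sets M" "\<And>i. P i \<Longrightarrow> emeasure M (V i) \<le> ennreal (K * d i)"
    and "K \<ge> 0"
  shows "emeasure M A \<le> ennreal K * (\<Sum>i. if P i then ennreal (d i) else 0)"
proof -
  define W where "W i = (if P i then V i else {})" for i
  have W: "range W \<subseteq> sets M" using V(1) by (auto simp: W_def)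
  have "emeasure M A \<le> emeasure M (\<Union>i. W i)"
  proof (rule emeasure_mono)
    show "A \<subseteq> (\<Union>i. W i)" using cov by (fastforce simp: W_def)
  qed (use W in auto)
  also have "\<dots> \<le> (\<Sum>i. emeasure M (W i))"
    by (rule emeasure_subadditive_countably[OF W])
  also have "\<dots> \<le> (\<Sum>i. ennreal K * (if P i then ennreal (d i) else 0))"
    using V(2) assms(4) by (intro suminf_le) (auto simp: W_def ennreal_mult')
  finally show ?thesis by simp
qed

text \<open>If neither the vertical line through a point of \<open>E\<close> nor the horizontal line through a point
  outside \<open>E\<close> met the boundary inside the cell, their intersection would be both in and outside \<open>E\<close>.
  So one of the two projections of the boundary yields strips covering \<open>E\<close> or its complement.\<close>

lemma emeasure_cell_le_suminf_diameter:
  assumes s: "s > 0" and "open E"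
    and cov: "frontier E \<subseteq> (\<Union>i. C i)" and bdd: "\<And>i. bounded (C i)"
    and half: "2 * emeasure lborel (E \<inter> cell s -` {p}) \<le> ennreal (s\<^sup>2)"
  shows "emeasure lborel (E \<inter> cell s -` {p}) \<le>
    ennreal (2 * s) * (\<Sum>i. if C i \<inter> cell s -` {p} \<noteq> {} then ennreal (diameter (C i)) else 0)"
    (is "_ \<le> ?rhs")
proof -
  define Q where "Q = cell s -` {p}"
  \<comment> \<open>A meaningless value when \<open>C i\<close> misses \<open>Q\<close>; such
    indices are excluded wherever \<open>c i\<close> is used.\<close>
  define c where "c i = (SOME y. y \<in> C i \<inter> Q)" for i
  define V where "V l i = Q \<inter> {x. \<bar>x $ l - c i $ l\<bar> \<le> diameter (C i)}" for l i
  have Q_sets [measurable]: "Q \<in> sets borel" unfolding Q_def by measurable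
  have E_sets [measurable]: "E \<in> sets borel" using \<open>open E\<close> by auto
  have near: "\<bar>u $ l - c i $ l\<bar> \<le> diameter (C i)" if "u \<in> C i \<inter> Q" for u l i
  proof -
    have "c i \<in> C i \<inter> Q" unfolding c_def using that by (rule someI)
    then have "dist u (c i) \<le> diameter (C i)"
      using that diameter_bounded_bound[OF bdd] by auto
    then show ?thesis
      using component_le_norm_cart[of "u - c i" l] by (simp add: dist_norm)
  qed
  have V_sets: "V l i \<in> sets lborel" for l i
  proof -
    have "closed {x :: real^2. \<bar>x $ l - c i $ l\<bar> \<le> diameter (C i)}"
      by (intro closed_Collect_le continuous_intros)
    then show ?thesis unfolding V_def by (auto intro!: sets.Int Q_sets)
  qed
  have small: "emeasure lborel A \<le> ?rhs"
    if "\<And>x. x \<in> A \<Longrightarrow> \<exists>i. C i \<inter> Q \<noteq> {} \<and> x \<in> V l i" for A l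
    unfolding Q_def[symmetric]
  proof (rule emeasure_le_incidence_suminf[OF that V_sets])
    fix i
    show "emeasure lborel (V l i) \<le> ennreal (2 * s * diameter (C i))"
      unfolding V_def Q_def by (rule emeasure_strip_le[OF s diameter_ge_0[OF bdd]])
  qed (use s in auto)
  \<comment> \<open>The segment from \<open>x\<close> to \<open>y\<close> is parallel to an axis and
    contains a boundary point with the same \<open>l\<close>-coordinate as \<open>z\<close>; the
    cover set through that point puts \<open>z\<close> into its strip.\<close>
  have cross: "\<exists>i. C i \<inter> Q \<noteq> {} \<and> z \<in> V l i"
    if "x \<in> Q" "y \<in> Q" "x \<in> E" "y \<notin> E" "x $ l = z $ l" "y $ l = z $ l" "z \<in> Q" for x y z l
  proof -
    obtain u where u: "u \<in> closed_segment x y" "u \<in> frontier E"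
      using frontier_between[OF connected_segment ends_in_segment \<open>x \<in> E\<close> \<open>y \<notin> E\<close>] .
    have "u \<in> Q" using cell_convex[OF s _ _ u(1)] that by (auto simp: Q_def)
    moreover obtain i where "u \<in> C i" using u(2) cov by auto
    moreover have "u $ l = z $ l"
    proof -
      obtain t where "u = (1 - t) *\<^sub>R x + t *\<^sub>R y" using u(1) by (auto simp: in_segment)
      with that show ?thesis by (simp add: left_diff_distrib)
    qed
    ultimately show ?thesis
      using near[of u i l] that by (auto simp: V_def)
  qed
  show ?thesis
  proof (cases "\<forall>x \<in> E \<inter> Q. \<exists>i. C i \<inter> Q \<noteq> {} \<and> x \<in> V 1 i")
    case True
    then have "emeasure lborel (E \<inter> Q) \<le> ?rhs" by (intro small[of _ 1]) blast
    then show ?thesis by (simp add: Q_def)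
  next
    case False
    then obtain x where x: "x \<in> E" "x \<in> Q" "\<not> (\<exists>i. C i \<inter> Q \<noteq> {} \<and> x \<in> V 1 i)" by blast
    have "\<exists>i. C i \<inter> Q \<noteq> {} \<and> z \<in> V 2 i" if z: "z \<in> Q - E" for z
    proof -
      define w :: "real^2" where "w = vector [x $ 1, z $ 2]"
      have w: "w $ 1 = x $ 1" "w $ 2 = z $ 2" by (auto simp: w_def)
      have wQ: "w \<in> Q" using x(2) z by (auto simp: Q_def cell_def w)
      show ?thesis
      proof (cases "w \<in> E")
        case True
        then show ?thesis using cross[of w z 2 z] wQ z w by auto
      next
        case False
        then show ?thesis using cross[of x w 1 x] wQ x w by blast
      qed
    qed
    then have rest: "emeasure lborel (Q - E) \<le> ?rhs" by (intro small) blast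
    have split: "emeasure lborel Q = emeasure lborel (E \<inter> Q) + emeasure lborel (Q - E)"
      by (subst plus_emeasure) (auto intro!: arg_cong[where f = "emeasure lborel"])
    have area: "emeasure lborel Q = ennreal (s\<^sup>2)"
      unfolding Q_def by (rule emeasure_cell[OF s])
    \<comment> \<open>The strips cover the part of the cell outside \<open>E\<close>; by
      \<open>half\<close>, that part is at least as large as \<open>E \<inter> Q\<close>. Cancelling
      in \<open>ennreal\<close> requires finiteness.\<close>
    have "emeasure lborel (E \<inter> Q) + emeasure lborel (E \<inter> Q) \<le>
        emeasure lborel (E \<inter> Q) + emeasure lborel (Q - E)"
      using half unfolding mult_2 Q_def[symmetric] area[symmetric] split .
    moreover have "emeasure lborel (E \<inter> Q) \<noteq> top"
      using split area by (metis ennreal_add_eq_top ennreal_neq_top)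
    ultimately have "emeasure lborel (E \<inter> Q) \<le> emeasure lborel (Q - E)"
      by (auto simp: ennreal_add_left_cancel_le)
    from order_trans[OF this rest] show ?thesis unfolding Q_def .
  qed
qed

text \<open>The circle about \<open>x\<close> through a point of \<open>E\<close> also leaves
  \<open>E\<close>, hence meets the boundary and some \<open>C i\<close>. The radius of that circle
  differs by at most the diameter of \<open>C i\<close> from that of a fixed point of
  \<open>C i\<close>, so annuli cover \<open>E\<close> in the disk.\<close>

lemma emeasure_ball_le_suminf_diameter:
  fixes E :: "(real^2) set"
  assumes "x \<notin> E" and circles: "\<And>\<rho>. 0 < \<rho> \<Longrightarrow> \<rho> < R \<Longrightarrow> \<exists>z \<in> sphere x \<rho>. z \<notin> E"
    and cov: "frontier E \<subseteq> (\<Union>i. C i)" and bdd: "\<And>i. bounded (C i)"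
    and diam: "\<And>i. diameter (C i) \<le> R" and "R \<ge> 0"
  shows "emeasure lborel (E \<inter> ball x R) \<le>
    ennreal (4 * pi * R) * (\<Sum>i. if C i \<inter> ball x R \<noteq> {} then ennreal (diameter (C i)) else 0)"
proof -
  define c where "c i = (SOME y. y \<in> C i \<inter> ball x R)" for i
  have c: "c i \<in> C i \<inter> ball x R" if "C i \<inter> ball x R \<noteq> {}" for i
    unfolding c_def using that by (metis ex_in_conv someI_ex)
  show ?thesis
  proof (rule emeasure_le_incidence_suminf
      [where V = "\<lambda>i. {y. \<bar>dist x y - dist x (c i)\<bar> \<le> diameter (C i)}"])
    fix y assume y: "y \<in> E \<inter> ball x R"
    \<comment> \<open>\<open>x \<notin> E\<close> rules out the degenerate circle of radius
      0.\<close>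
    then have "0 < dist x y" "dist x y < R" using \<open>x \<notin> E\<close> by auto
    then obtain z where z: "z \<in> sphere x (dist x y)" "z \<notin> E" using circles by blast
    have "connected (sphere x (dist x y))" by (rule connected_sphere) simp
    then obtain u where u: "u \<in> sphere x (dist x y)" "u \<in> frontier E"
      using frontier_between[of "sphere x (dist x y)" y z E] y z by auto
    then obtain i where i: "u \<in> C i" using cov by auto
    have ne: "C i \<inter> ball x R \<noteq> {}" using i u(1) \<open>dist x y < R\<close> by auto
    have "dist u (c i) \<le> diameter (C i)"
      using c[OF ne] i diameter_bounded_bound[OF bdd] by auto
    moreover have "\<bar>dist x u - dist x (c i)\<bar> \<le> dist u (c i)"
      by (metis abs_dist_diff_le dist_commute)
    ultimately show "\<exists>i. C i \<inter> ball x R \<noteq> {} \<and> y \<in> {y. \<bar>dist x y - dist x (c i)\<bar> \<le> diameter (C i)}"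
      using ne u(1) by (intro exI[of _ i]) auto
  next
    fix i
    have "closed {y. \<bar>dist x y - dist x (c i)\<bar> \<le> diameter (C i)}"
      by (intro closed_Collect_le continuous_intros)
    then show "{y. \<bar>dist x y - dist x (c i)\<bar> \<le> diameter (C i)} \<in> sets lborel" by auto
    assume "C i \<inter> ball x R \<noteq> {}"
    then have "dist x (c i) \<le> R" using c by fastforce
    then show "emeasure lborel {y. \<bar>dist x y - dist x (c i)\<bar> \<le> diameter (C i)}
        \<le> ennreal (4 * pi * R * diameter (C i))"
      by (intro emeasure_annulus_le diam diameter_ge_0 bdd) auto
  qed (use \<open>R \<ge> 0\<close> in auto)
qed

section \<open>Components of the complement in the one-point compactification\<close>

text \<open>The point at infinity is \<open>None\<close>, so a component containing it is never
  confined to the image of a disk under \<open>Some\<close>.\<close>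

abbreviation compl_component :: "(real^2) set \<Rightarrow> real^2 \<Rightarrow> (real^2) option set" where
  "compl_component \<Omega> x \<equiv>
     connected_component_of_set
       (subtopology (Alexandroff_compactification euclidean)
         (topspace (Alexandroff_compactification euclidean) - Some ` \<Omega>)) (Some x)"

lemma mem_compl_component: "x \<notin> \<Omega> \<Longrightarrow> Some x \<in> compl_component \<Omega> x"
  by (auto simp: connected_component_of_refl)

text \<open>If the circle lay in \<open>\<Omega>\<close>, its interior and its exterior (together
  with infinity) would disconnect the component, which contains \<open>x\<close> and also leaves the
  larger disk.\<close>

lemma circle_meets_complement:
  assumes "x \<notin> \<Omega>" "\<not> compl_component \<Omega> x \<subseteq> Some ` ball x R" "0 < \<rho>" "\<rho> < R"
  shows "\<exists>z \<in> sphere x \<rho>. z \<notin> \<Omega>"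
proof (rule ccontr)
  assume no: "\<not> (\<exists>z \<in> sphere x \<rho>. z \<notin> \<Omega>)"
  let ?S = "Alexandroff_compactification (euclidean :: (real^2) topology)"
  let ?C = "compl_component \<Omega> x"
  let ?U = "Some ` ball x \<rho>" and ?V = "topspace ?S - Some ` cball x \<rho>"
  have C: "connectedin ?S ?C" "?C \<subseteq> topspace ?S - Some ` \<Omega>"
    using connectedin_connected_component_of[of
        "subtopology ?S (topspace ?S - Some ` \<Omega>)" "Some x"]
    by (auto simp: connectedin_subtopology)
  have U: "openin ?S ?U" by (auto simp: openin_Alexandroff_compactification)
  \<comment> \<open>The complement of a compact set is a neighbourhood of infinity.\<close>
  have V: "openin ?S ?V"
    unfolding openin_Alexandroff_compactification
    by (rule disjI2, rule exI[of _ "cball x \<rho>"]) auto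
  have "?C \<subseteq> ?U \<union> ?V"
  proof
    fix a assume "a \<in> ?C"
    with C(2) have a: "a \<in> topspace ?S" "a \<notin> Some ` \<Omega>" by auto
    show "a \<in> ?U \<union> ?V"
    proof (cases a)
      case (Some y)
      then have "dist x y \<noteq> \<rho>" using no a(2) by auto
      then show ?thesis using Some by (cases "dist x y < \<rho>") auto
    qed auto
  qed
  moreover have "?U \<inter> ?V \<inter> ?C = {}" by auto
  moreover have "?U \<inter> ?C \<noteq> {}" using mem_compl_component[OF assms(1)] assms(3) by force
  moreover have "?V \<inter> ?C \<noteq> {}"
  proof -
    obtain a where "a \<in> ?C" "a \<notin> Some ` ball x R" using assms(2) by blast
    with C(2) assms(4) have "a \<in> ?V" by auto
    with \<open>a \<in> ?C\<close> show ?thesis by blast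
  qed
  ultimately show False using connectedinD[OF C(1) U V] by blast
qed

text \<open>If \<open>p\<close> and \<open>q\<close> had the same component, then \<open>x q\<close>
  would lie in the disk of radius \<open>R\<close> about \<open>x p\<close>, against the separation.
  So \<open>P\<close> injects into the finite set of components.\<close>

lemma card_confined_components_le:
  assumes "multiply_connected_of_order k \<Omega>"
    and P: "\<And>p. p \<in> P \<Longrightarrow> x p \<notin> \<Omega>"
      "\<And>p. p \<in> P \<Longrightarrow> compl_component \<Omega> (x p) \<subseteq> Some ` ball (x p) R"
    and sep: "\<And>p q. p \<in> P \<Longrightarrow> q \<in> P \<Longrightarrow> p \<noteq> q \<Longrightarrow> R \<le> dist (x p) (x q)"
  shows "finite P" "card P \<le> k"
proof -
  let ?S = "Alexandroff_compactification (euclidean :: (real^2) topology)"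
  let ?K = "connected_components_of (subtopology ?S (topspace ?S - Some ` \<Omega>))"
  have K: "finite ?K" "card ?K = k"
    using assms(1) by (auto simp: multiply_connected_of_order_def Let_def)
  have inj: "inj_on (\<lambda>p. compl_component \<Omega> (x p)) P"
  proof (rule inj_onI, rule ccontr)
    fix p q assume pq: "p \<in> P" "q \<in> P" "compl_component \<Omega> (x p) = compl_component \<Omega> (x q)" "p \<noteq> q"
    have "Some (x q) \<in> Some ` ball (x p) R"
      using mem_compl_component[OF P(1)[OF pq(2)]] P(2)[OF pq(1)] pq(3) by blast
    then show False using sep[OF pq(1,2,4)] by auto
  qed
  have into: "(\<lambda>p. compl_component \<Omega> (x p)) ` P \<subseteq> ?K"
    using P(1) by (auto simp: connected_component_in_connected_components_of)
  show "finite P" using inj_on_finite[OF inj into K(1)] .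
  show "card P \<le> k" using card_inj_on_le[OF inj into K(1)] K(2) by simp
qed

section \<open>Cell centres and the splitting of areas\<close>

definition cell_centre :: "real \<Rightarrow> int \<times> int \<Rightarrow> real^2" where
  "cell_centre s p = vector [s * (real_of_int (fst p) + 1 / 2), s * (real_of_int (snd p) + 1 / 2)]"

lemma cell_centre_nth:
  "cell_centre s p $ 1 = s * (real_of_int (fst p) + 1 / 2)"
  "cell_centre s p $ 2 = s * (real_of_int (snd p) + 1 / 2)"
  by (simp_all add: cell_centre_def)

text \<open>Half the diagonal is \<open>s / sqrt 2\<close>; the factor \<open>3 / 4\<close> is a
  convenient rational upper bound.\<close>

lemma dist_cell_centre_le:
  assumes "s > 0"
  shows "dist (cell_centre s (cell s y)) y \<le> 3 / 4 * s"
proof -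
  obtain i j where p: "cell s y = (i, j)" by force
  let ?v = "cell_centre s (cell s y) - y"
  have "\<bar>?v $ 1\<bar> \<le> s / 2" "\<bar>?v $ 2\<bar> \<le> s / 2"
    using p assms unfolding cell_eq_iff[OF assms]
    by (auto simp: p cell_centre_nth algebra_simps abs_if)
  then have "(?v $ 1)\<^sup>2 \<le> (s / 2)\<^sup>2" "(?v $ 2)\<^sup>2 \<le> (s / 2)\<^sup>2"
    using assms by (simp_all add: abs_le_square_iff[symmetric])
  then have "(norm ?v)\<^sup>2 \<le> (s / 2)\<^sup>2 + (s / 2)\<^sup>2"
    by (simp add: norm_vec_def L2_set_def sum_2)
  also have "\<dots> \<le> (3 / 4 * s)\<^sup>2" by (simp add: power2_eq_square)
  finally have "norm ?v \<le> 3 / 4 * s"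
    by (rule power2_le_imp_le) (use assms in simp)
  then show ?thesis by (simp add: dist_norm)
qed

lemma cell_eqI_dist_centre:
  assumes "s > 0" "dist (cell_centre s p) y < s / 2"
  shows "cell s y = p"
proof -
  obtain i j where p: "p = (i, j)" by force
  have "\<bar>(cell_centre s p - y) $ l\<bar> < s / 2" for l
    using assms(2) component_le_norm_cart[of "cell_centre s p - y" l] by (simp add: dist_norm)
  from this[of 1] this[of 2] show ?thesis
    unfolding p cell_eq_iff[OF assms(1)]
    by (auto simp: cell_centre_nth algebra_simps abs_if split: if_splits)
qed

lemma dist_cell_centres_ge:
  assumes "s > 0" "p \<noteq> q"
  shows "s \<le> dist (cell_centre s p) (cell_centre s q)"
proof -
  have *: "s \<le> \<bar>s * (of_int i + 1 / 2) - s * (of_int j + 1 / 2)\<bar>" if "i \<noteq> j" for i j :: int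
  proof -
    have "1 \<le> \<bar>i - j\<bar>" using that by simp
    then have "s * 1 \<le> s * \<bar>of_int i - of_int j\<bar>"
      using assms(1) by (intro mult_left_mono) (simp_all flip: of_int_diff of_int_abs)
    also have "\<dots> = \<bar>s * (of_int i - of_int j)\<bar>"
      using assms(1) by (simp add: abs_mult)
    finally show ?thesis by (simp add: algebra_simps)
  qed
  have le: "\<bar>(cell_centre s p - cell_centre s q) $ l\<bar> \<le> dist (cell_centre s p) (cell_centre s q)" for l
    unfolding dist_norm by (rule component_le_norm_cart)
  consider "fst p \<noteq> fst q" | "snd p \<noteq> snd q" using assms(2) by (auto simp: prod_eq_iff)
  then show ?thesis
  proof cases
    case 1
    from *[OF this] le[of 1] show ?thesis by (simp add: cell_centre_nth)
  next
    case 2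
    from *[OF this] le[of 2] show ?thesis by (simp add: cell_centre_nth)
  qed
qed

lemma emeasure_eq_sum_cells:
  assumes "finite F" "cell s ` A \<subseteq> F" and [measurable]: "A \<in> sets borel"
  shows "emeasure lborel A = (\<Sum>p\<in>F. emeasure lborel (A \<inter> cell s -` {p}))"
proof -
  have "(\<Sum>p\<in>F. emeasure lborel (A \<inter> cell s -` {p})) = emeasure lborel (\<Union>p\<in>F. A \<inter> cell s -` {p})"
    using assms(1) by (intro sum_emeasure) (auto simp: disjoint_family_on_def)
  also have "(\<Union>p\<in>F. A \<inter> cell s -` {p}) = A" using assms(2) by auto
  finally show ?thesis by simp
qed

lemma emeasure_le_two_emeasure_Int:
  assumes [measurable]: "A \<in> sets M" "G \<in> sets M" and "emeasure M A \<noteq> top"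
    and "2 * emeasure M (A - G) \<le> emeasure M A"
  shows "emeasure M A \<le> 2 * emeasure M (A \<inter> G)"
proof -
  have eq: "emeasure M A = emeasure M (A \<inter> G) + emeasure M (A - G)"
    by (subst plus_emeasure) (auto intro!: arg_cong[where f = "emeasure M"])
  with assms(3) have "emeasure M (A - G) \<noteq> top" by auto
  moreover have "emeasure M (A - G) + emeasure M (A - G) \<le> emeasure M (A - G) + emeasure M (A \<inter> G)"
    using assms(4) eq by (simp add: mult_2 add.commute)
  ultimately have "emeasure M (A - G) \<le> emeasure M (A \<inter> G)"
    by (simp add: ennreal_add_left_cancel_le)
  then show ?thesis unfolding eq mult_2 by (rule add_left_mono)
qed

section \<open>The global area estimate\<close>

lemma emeasure_le_suminf_diameter:
  assumes \<Omega>: "multiply_connected_of_order k \<Omega>" and k: "k \<noteq> 0"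
    and no_ball: "\<And>x. \<not> ball x \<rho> \<subseteq> \<Omega>" and \<rho>: "\<rho> > 0"
    and E: "open E" "bounded E" "E \<subseteq> \<Omega>"
    and cov: "frontier E \<subseteq> (\<Union>i. C i)" and bdd: "\<And>i. bounded (C i)"
    and diam: "\<And>i. diameter (C i) \<le> \<rho>"
  shows "emeasure lborel E \<le> ennreal (3312 * sqrt k * \<rho>) * (\<Sum>i. ennreal (diameter (C i)))"
proof -
  \<comment> \<open>The numbers fit as follows: \<open>3 / 4 * s + \<rho> = R\<close> puts each cell
    inside the disk about \<open>x p\<close>; \<open>s - 2 * \<rho> = R\<close> separates these
    points; \<open>R + \<rho> < s\<close> gives the incidence bound nine. Finally
    \<open>L\<^sup>2 = 4 * k * s\<^sup>2\<close>, so \<open>k\<close> small cells fill at most a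
    quarter of a large one.\<close>
  define s R L where "s = 12 * \<rho>" and "R = 10 * \<rho>" and "L = 2 * sqrt k * s"
  have pos: "s > 0" "R > 0" "L > 0" using \<rho> k by (auto simp: s_def R_def L_def)
  have sqrt_k: "1 \<le> sqrt k" using k by simp
  have "\<rho> < L"
  proof -
    have "\<rho> < 2 * 1 * s" using \<rho> by (simp add: s_def)
    also have "\<dots> \<le> L" unfolding L_def using sqrt_k pos by (intro mult_right_mono) auto
    finally show ?thesis .
  qed
  define D where "D = (\<Sum>i. ennreal (diameter (C i)))"
  have E_sets [measurable]: "E \<in> sets borel" using E(1) by auto
  have E_fin: "emeasure lborel A \<noteq> top" if "A \<subseteq> E" for A
    using emeasure_bounded_finite[OF bounded_subset[OF E(2) that]] by simp

  have "\<exists>x. \<forall>p. x p \<in> ball (cell_centre s p) \<rho> - \<Omega>"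
    using no_ball by (intro choice) blast
  then obtain x where x: "\<And>p. dist (cell_centre s p) (x p) < \<rho>" "\<And>p. x p \<notin> \<Omega>"
    by (auto simp: Ball_def)
  have cell_x: "cell s (x p) = p" for p
    using x(1)[of p] \<rho> by (intro cell_eqI_dist_centre pos) (simp add: s_def)
  have cell_sub: "cell s -` {p} \<subseteq> ball (x p) R" for p
  proof
    fix y assume "y \<in> cell s -` {p}"
    then have "dist (cell_centre s p) y \<le> 3 / 4 * s" using dist_cell_centre_le[OF pos(1), of y] by auto
    with x(1)[of p] dist_triangle3[of "x p" y "cell_centre s p"] show "y \<in> ball (x p) R"
      by (simp add: s_def R_def)
  qed

  define Bad where "Bad = {p. compl_component \<Omega> (x p) \<subseteq> Some ` ball (x p) R}"
  have sep: "R \<le> dist (x p) (x q)" if "p \<noteq> q" for p q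
    using dist_cell_centres_ge[OF pos(1) that] x(1)[of p] x(1)[of q]
      dist_triangle[of "cell_centre s p" "cell_centre s q" "x p"]
      dist_triangle2[of "x p" "cell_centre s q" "x q"]
    by (simp add: s_def R_def dist_commute)
  have Bad: "finite Bad" "card Bad \<le> k"
    by (rule card_confined_components_le[OF \<Omega>, of Bad x R]; use x(2) sep in \<open>auto simp: Bad_def\<close>)+
  define G where "G = cell s -` (- Bad)"
  have [measurable]: "G \<in> sets borel" by (simp add: G_def sets_cell_vimage)
  have area_Bad: "emeasure lborel (- G) \<le> ennreal (k * s\<^sup>2)"
  proof -
    have "emeasure lborel (- G) = emeasure lborel (\<Union>p\<in>Bad. cell s -` {p})"
      by (intro arg_cong[where f = "emeasure lborel"]) (auto simp: G_def)
    also have "\<dots> \<le> (\<Sum>p\<in>Bad. emeasure lborel (cell s -` {p}))"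
      using Bad(1) by (intro emeasure_subadditive_finite) auto
    also have "\<dots> = of_nat (card Bad) * ennreal (s\<^sup>2)"
      by (simp add: emeasure_cell[OF pos(1)])
    also have "\<dots> \<le> of_nat k * ennreal (s\<^sup>2)"
      using Bad(2) by (intro mult_right_mono) auto
    finally show ?thesis by (simp add: ennreal_mult ennreal_of_nat_eq_real_of_nat)
  qed

  \<comment> \<open>Each good cell is handled by the circles about \<open>x p\<close>. A cover set
    meeting the disk about \<open>x p\<close> lies within \<open>s\<close> of that point, which is
    in cell \<open>p\<close>, so it is counted at most nine times.\<close>
  have good: "emeasure lborel (E \<inter> G) \<le> ennreal (4 * pi * R) * (9 * D)"
  proof -
    define F where "F = cell s ` E"
    have "finite F" unfolding F_def by (rule finite_cell_image[OF pos(1) E(2)])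
    let ?P = "\<lambda>p i. p \<notin> Bad \<and> C i \<inter> ball (x p) R \<noteq> {}"
    have "emeasure lborel (E \<inter> G) = (\<Sum>p\<in>F. emeasure lborel (E \<inter> G \<inter> cell s -` {p}))"
      using \<open>finite F\<close> by (intro emeasure_eq_sum_cells) (auto simp: F_def)
    also have "\<dots> \<le> (\<Sum>p\<in>F. ennreal (4 * pi * R) * (\<Sum>i. if ?P p i then ennreal (diameter (C i)) else 0))"
    proof (rule sum_mono)
      fix p
      show "emeasure lborel (E \<inter> G \<inter> cell s -` {p}) \<le>
        ennreal (4 * pi * R) * (\<Sum>i. if ?P p i then ennreal (diameter (C i)) else 0)"
      proof (cases "p \<in> Bad")
        case True
        then have "E \<inter> G \<inter> cell s -` {p} = {}" by (auto simp: G_def)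
        then show ?thesis by simp
      next
        case False
        have "emeasure lborel (E \<inter> G \<inter> cell s -` {p}) \<le> emeasure lborel (E \<inter> ball (x p) R)"
          using cell_sub[of p] by (intro emeasure_mono) auto
        also have "\<dots> \<le> ennreal (4 * pi * R) *
            (\<Sum>i. if C i \<inter> ball (x p) R \<noteq> {} then ennreal (diameter (C i)) else 0)"
        proof (rule emeasure_ball_le_suminf_diameter[OF _ _ cov bdd])
          show "x p \<notin> E" using x(2) E(3) by blast
          show "\<exists>z\<in>sphere (x p) t. z \<notin> E" if "0 < t" "t < R" for t
            using circle_meets_complement[of "x p" \<Omega> R t] x(2) E(3) False that
            by (auto simp: Bad_def)
          show "diameter (C i) \<le> R" for i using diam[of i] \<rho> by (simp add: R_def)
        qed (use pos in auto)
        finally show ?thesis using False by simp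
      qed
    qed
    also have "\<dots> = ennreal (4 * pi * R) * (\<Sum>p\<in>F. \<Sum>i. if ?P p i then ennreal (diameter (C i)) else 0)"
      by (simp add: sum_distrib_left)
    also have "\<dots> \<le> ennreal (4 * pi * R) * (of_nat 9 * D)"
      unfolding D_def
    proof (intro mult_left_mono sum_suminf_incidence_le \<open>finite F\<close>)
      fix i
      show "card {p \<in> F. ?P p i} \<le> 9"
      proof (cases "C i = {}")
        case False
        then obtain c where c: "c \<in> C i" by blast
        show ?thesis
        proof (rule card_cells_near[OF pos(1), of _ c])
          fix p assume "p \<in> {p \<in> F. ?P p i}"
          then obtain y where y: "y \<in> C i" "dist (x p) y < R" by auto
          have "dist c y \<le> \<rho>" using diameter_bounded_bound[OF bdd c y(1)] diam[of i] by simp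
          then have "dist c (x p) < s"
            using y(2) dist_triangle2[of c "x p" y] \<rho> by (simp add: s_def R_def)
          then show "\<exists>y. dist c y < s \<and> cell s y = p" using cell_x by blast
        qed
      qed simp
    qed simp
    finally show ?thesis by simp
  qed

  define S where "S p = (\<Sum>i. if C i \<inter> cell L -` {p} \<noteq> {} then ennreal (diameter (C i)) else 0)" for p
  \<comment> \<open>The two summands cover the two alternatives: the isoperimetric term if
    \<open>E\<close> fills at most half of the large cell, the good part otherwise.\<close>
  have large: "emeasure lborel (E \<inter> cell L -` {p}) \<le>
      2 * emeasure lborel (E \<inter> G \<inter> cell L -` {p}) + ennreal (2 * L) * S p" for p
  proof (cases "2 * emeasure lborel (E \<inter> cell L -` {p}) \<le> ennreal (L\<^sup>2)")
    case True
    then show ?thesis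
      unfolding S_def
      using emeasure_cell_le_suminf_diameter[OF pos(3) E(1) cov bdd True]
      by (meson add_increasing zero_le)
  next
    case False
    let ?A = "E \<inter> cell L -` {p}"
    \<comment> \<open>The bad cells have area at most \<open>L\<^sup>2 / 4\<close>, which is at most
      half the area of \<open>?A\<close>. Everything is multiplied by 4 to avoid division in
      \<open>ennreal\<close>.\<close>
    have "2 * (2 * emeasure lborel (?A - G)) \<le> 2 * (2 * emeasure lborel (- G))"
      by (intro mult_left_mono emeasure_mono) auto
    also have "\<dots> \<le> 2 * (2 * ennreal (k * s\<^sup>2))"
      using area_Bad by (intro mult_left_mono) auto
    also have "\<dots> = ennreal (L\<^sup>2)"
      by (simp add: L_def power_mult_distrib ennreal_mult mult.assoc[symmetric])
    also have "\<dots> \<le> 2 * emeasure lborel ?A" using False by simp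
    finally have "2 * (2 * emeasure lborel (?A - G)) \<le> 2 * emeasure lborel ?A" .
    then have "2 * emeasure lborel (?A - G) \<le> emeasure lborel ?A"
      by (subst (asm) ennreal_mult_le_mult_iff) auto
    then have "emeasure lborel ?A \<le> 2 * emeasure lborel (?A \<inter> G)"
      by (intro emeasure_le_two_emeasure_Int E_fin) auto
    also have "?A \<inter> G = E \<inter> G \<inter> cell L -` {p}" by auto
    finally show ?thesis by (meson add_increasing2 zero_le order_trans order_refl)
  qed

  define F where "F = cell L ` E"
  have "finite F" unfolding F_def by (rule finite_cell_image[OF pos(3) E(2)])
  have "emeasure lborel E = (\<Sum>p\<in>F. emeasure lborel (E \<inter> cell L -` {p}))"
    using \<open>finite F\<close> by (intro emeasure_eq_sum_cells) (auto simp: F_def)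
  also have "\<dots> \<le> (\<Sum>p\<in>F. 2 * emeasure lborel (E \<inter> G \<inter> cell L -` {p}) + ennreal (2 * L) * S p)"
    by (rule sum_mono) (rule large)
  also have "\<dots> = 2 * (\<Sum>p\<in>F. emeasure lborel (E \<inter> G \<inter> cell L -` {p})) + ennreal (2 * L) * (\<Sum>p\<in>F. S p)"
    by (simp add: sum.distrib sum_distrib_left)
  also have "(\<Sum>p\<in>F. emeasure lborel (E \<inter> G \<inter> cell L -` {p})) = emeasure lborel (E \<inter> G)"
    using \<open>finite F\<close> by (intro emeasure_eq_sum_cells[symmetric]) (auto simp: F_def)
  also have "2 * emeasure lborel (E \<inter> G) + ennreal (2 * L) * (\<Sum>p\<in>F. S p) \<le>
      2 * (ennreal (4 * pi * R) * (9 * D)) + ennreal (2 * L) * (9 * D)"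
  proof (intro add_mono mult_left_mono good)
    have "(\<Sum>p\<in>F. S p) \<le> of_nat 9 * D"
      unfolding S_def D_def
    proof (rule sum_suminf_incidence_le[OF \<open>finite F\<close>])
      fix i
      show "card {p \<in> F. C i \<inter> cell L -` {p} \<noteq> {}} \<le> 9"
      proof (cases "C i = {}")
        case False
        then obtain c where c: "c \<in> C i" by blast
        show ?thesis
        proof (rule card_cells_near[OF pos(3), of _ c])
          fix p assume "p \<in> {p \<in> F. C i \<inter> cell L -` {p} \<noteq> {}}"
          then obtain y where y: "y \<in> C i" "cell L y = p" by auto
          have "dist c y < L"
            using diameter_bounded_bound[OF bdd c y(1)] diam[of i] \<open>\<rho> < L\<close> by simp
          then show "\<exists>y. dist c y < L \<and> cell L y = p" using y by blast
        qed
      qed simp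
    qed
    then show "(\<Sum>p\<in>F. S p) \<le> 9 * D" by simp
  qed auto
  also have "\<dots> = ennreal (72 * pi * R + 18 * L) * D"
  proof -
    have "ennreal (72 * pi * R + 18 * L) = 18 * ennreal (4 * pi * R) + 9 * ennreal (2 * L)"
      using pos by (simp add: ennreal_mult[symmetric] ennreal_plus[symmetric]
          ennreal_numeral[symmetric] del: ennreal_plus ennreal_numeral)
    then show ?thesis by (simp add: algebra_simps)
  qed
  also have "\<dots> \<le> ennreal (3312 * sqrt k * \<rho>) * D"
  proof (intro mult_right_mono ennreal_leI)
    \<comment> \<open>With \<open>pi < 4\<close> the first term contributes 2880, and
      \<open>18 * L = 432 * sqrt k * \<rho>\<close>; the sum is 3312.\<close>
    have "72 * pi * R \<le> 72 * 4 * R" using pi_less_4 pos by (intro mult_right_mono) auto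
    also have "\<dots> = 2880 * \<rho> * 1" by (simp add: R_def)
    also have "\<dots> \<le> 2880 * \<rho> * sqrt k" using sqrt_k \<rho> by (intro mult_left_mono) auto
    finally show "72 * pi * R + 18 * L \<le> 3312 * sqrt k * \<rho>"
      by (simp add: L_def s_def)
  qed simp
  finally show ?thesis unfolding D_def .
qed

text \<open>The estimate holds for every cover by sets of diameter at most \<open>\<rho>\<close>,
  hence for the infimum at that scale, which is below the supremum over all scales.\<close>

lemma emeasure_le_hausdorff1_frontier:
  assumes "multiply_connected_of_order k \<Omega>" "k \<noteq> 0" "\<And>x. \<not> ball x \<rho> \<subseteq> \<Omega>" "\<rho> > 0"
    and "open E" "bounded E" "E \<subseteq> \<Omega>"
  shows "emeasure lborel E \<le> ennreal (3312 * sqrt k * \<rho>) * hausdorff1 (frontier E)"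
proof -
  define K where "K = 3312 * sqrt k * \<rho>"
  have K: "K > 0" using assms by (simp add: K_def)
  have "emeasure lborel E / ennreal K \<le> hausdorff_pre1 \<rho> (frontier E)"
    unfolding hausdorff_pre1_def
  proof (rule INF_greatest)
    fix C :: "nat \<Rightarrow> (real^2) set"
    assume "C \<in> {C. frontier E \<subseteq> (\<Union>i. C i) \<and> (\<forall>i. bounded (C i) \<and> diameter (C i) \<le> \<rho>)}"
    then have "emeasure lborel E \<le> ennreal K * (\<Sum>i. ennreal (diameter (C i)))"
      unfolding K_def using assms by (intro emeasure_le_suminf_diameter) auto
    then show "emeasure lborel E / ennreal K \<le> (\<Sum>i. ennreal (diameter (C i)))"
      using K by (intro divide_le_posI_ennreal) auto
  qed
  also have "\<dots> \<le> hausdorff1 (frontier E)"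
    unfolding hausdorff1_def using assms(4) by (intro SUP_upper) auto
  finally have "ennreal K * (emeasure lborel E / ennreal K) \<le> ennreal K * hausdorff1 (frontier E)"
    by (rule mult_left_mono) simp
  moreover have "ennreal K * (emeasure lborel E / ennreal K) = emeasure lborel E"
    using K by (simp add: ennreal_times_divide mult_divide_eq_ennreal mult.commute[of "ennreal _"])
  ultimately show ?thesis by (simp add: K_def)
qed

section \<open>The explicit constant and the Cheeger inequality\<close>

text \<open>A real infimum is bounded below by a common lower bound only over a nonempty set, so a
  nonconstant Lipschitz function is exhibited: the first coordinate.\<close>

lemma mu11_disk_nonneg: "0 \<le> mu11_disk"
  unfolding mu11_disk_def
proof (rule cINF_greatest)
  have "1-lipschitz_on (cball 0 1) (\<lambda>x :: real^2. x $ 1)"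
    by (rule lipschitz_onI) (auto simp: dist_real_def dist_norm intro: order_trans[OF _ component_le_norm_cart[of _ 1]])
  moreover have "\<not> (\<lambda>x :: real^2. x $ 1) constant_on cball 0 1"
  proof
    assume "(\<lambda>x :: real^2. x $ 1) constant_on cball 0 1"
    then obtain c where c: "\<And>x :: real^2. x \<in> cball 0 1 \<Longrightarrow> x $ 1 = c"
      by (auto simp: constant_on_def)
    from c[of 0] c[of "axis 1 1"] show False by simp
  qed
  ultimately show "{u :: real^2 \<Rightarrow> real. (\<exists>L. L-lipschitz_on (cball 0 1) u) \<and> \<not> u constant_on cball 0 1} \<noteq> {}"
    by blast
next
  fix u :: "real^2 \<Rightarrow> real"
  show "0 \<le> (LINT x:ball 0 1|lebesgue. norm (grad u x)) / (INF t. LINT x:ball 0 1|lebesgue. \<bar>u x - t\<bar>)"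
    unfolding set_lebesgue_integral_def
    by (intro divide_nonneg_nonneg cINF_greatest integral_nonneg) auto
qed

text \<open>The bracket is at least \<open>pi\<close>, so its inverse is at most 1 and the numerical
  prefactor decides. If \<open>mu11_disk\<close> were 0, the convention \<open>1 / 0 = 0\<close>
  would keep this valid. The bound is \<open>1 / (2 * 3312)\<close>.\<close>

lemma Theta11_bounds: "0 < Theta11" "Theta11 \<le> 1 / 6624"
proof -
  let ?X = "pi + 4 * pi / (1 - sqrt 2 / 2) * (1 / mu11_disk)"
  have "sqrt 2 < 2" by (rule real_less_lsqrt) auto
  then have "0 \<le> 4 * pi / (1 - sqrt 2 / 2) * (1 / mu11_disk)"
    using mu11_disk_nonneg by (intro mult_nonneg_nonneg divide_nonneg_nonneg) auto
  then have X: "?X \<ge> 1" using pi_gt3 by linarith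
  then have inv: "0 < inverse ?X" "inverse ?X \<le> 1"
    by (auto intro: inverse_le_1_iff[THEN iffD2])
  then show "0 < Theta11" by (simp add: Theta11_def C_const_def)
  have "Theta11 = 1 / (4 * 6 ^ 7 * 2 ^ 7) * (1 / 2) ^ 10 / (2 * 10 ^ 2) * inverse ?X"
    by (simp add: Theta11_def C_const_def)
  also have "\<dots> \<le> 1 / (4 * 6 ^ 7 * 2 ^ 7) * (1 / 2) ^ 10 / (2 * 10 ^ 2) * 1"
    using inv(2) by (intro mult_left_mono) auto
  also have "\<dots> \<le> 1 / 6624" by (simp add: power_one_over)
  finally show "Theta11 \<le> 1 / 6624" .
qed

theorem corollary5p2:
  fixes k :: nat
  assumes "k \<noteq> 0"
  shows "0 < Theta11 \<and>
    (\<forall>\<Omega> :: (real^2) set. multiply_connected_of_order k \<Omega> \<and> inradius \<Omega> < \<infinity> \<longrightarrow>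
       cheeger \<Omega> \<ge> ennreal (Theta11 / sqrt (real k)) * (1 / inradius \<Omega>))"
proof (intro conjI allI impI)
  show "0 < Theta11" by (rule Theta11_bounds)
  fix \<Omega> :: "(real^2) set"
  assume \<Omega>: "multiply_connected_of_order k \<Omega> \<and> inradius \<Omega> < \<infinity>"
  show "cheeger \<Omega> \<ge> ennreal (Theta11 / sqrt (real k)) * (1 / inradius \<Omega>)"
    unfolding cheeger_def
  proof (rule INF_greatest)
    fix E :: "(real^2) set"
    assume "E \<in> {E. open E \<and> E \<noteq> {} \<and> compact (closure E) \<and> closure E \<subseteq> \<Omega> \<and> smooth_boundary E}"
    then obtain x where E: "open E" "x \<in> E" "compact (closure E)" "closure E \<subseteq> \<Omega>" by blast
    define r where "r = enn2real (inradius \<Omega>)"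
    have inr: "inradius \<Omega> = ennreal r" unfolding r_def using \<Omega> by simp
    have inradius_upper: "ennreal t \<le> ennreal r" if "t > 0" "ball y t \<subseteq> \<Omega>" for t y
      unfolding inr[symmetric] inradius_def using that by (intro SUP_upper) auto
    have "x \<in> \<Omega>" "open \<Omega>"
      using E closure_subset \<Omega> by (auto simp: multiply_connected_of_order_def)
    then obtain t where t: "t > 0" "ball x t \<subseteq> \<Omega>" by (meson openE)
    \<comment> \<open>\<open>E\<close> is nonempty, so \<open>\<Omega>\<close> contains a disk and
      the inradius can be inverted.\<close>
    have r: "r > 0"
      using inradius_upper[OF t] t(1) by (metis ennreal_le_iff2 linorder_not_le order_trans)
    \<comment> \<open>A disk of radius \<open>r\<close> itself may lie in \<open>\<Omega>\<close>,
      as the supremum can be attained; doubling \<open>r\<close> excludes this and accounts for 6624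
      in place of 3312.\<close>
    have no_ball: "\<not> ball y (2 * r) \<subseteq> \<Omega>" for y
      using inradius_upper[of "2 * r" y] r by auto
    define K where "K = 3312 * sqrt k * (2 * r)"
    have K: "K > 0" using r assms by (simp add: K_def)
    have bE: "bounded E" by (rule bounded_subset[OF compact_imp_bounded[OF E(3)] closure_subset])
    have sub: "E \<subseteq> \<Omega>" by (rule order_trans[OF closure_subset E(4)])
    have area: "emeasure lborel E \<le> ennreal K * hausdorff1 (frontier E)"
      unfolding K_def
      by (rule emeasure_le_hausdorff1_frontier[OF _ assms no_ball _ E(1) bE sub]) (use \<Omega> r in auto)
    define e where "e = measure lborel E"
    have e: "emeasure lborel E = ennreal e"
      unfolding e_def using emeasure_bounded_finite[OF bE] by (intro emeasure_eq_ennreal_measure) auto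
    \<comment> \<open>A nonempty open set has positive area, so dividing by \<open>e\<close> is
      legitimate.\<close>
    have "E \<notin> null_sets lborel"
      using E(1,2) open_not_negligible[of E] null_sets_completionI[of E lborel]
      by (auto simp: negligible_iff_null_sets)
    then have e_pos: "e > 0" using E(1) by (cases "e > 0") (auto simp: null_sets_def e ennreal_neg)
    have "ennreal (Theta11 / sqrt (real k)) * (1 / inradius \<Omega>) = ennreal (Theta11 / sqrt k / r)"
    proof -
      have "1 / ennreal r = ennreal (1 / r)" using divide_ennreal[of 1 r] r by simp
      moreover have "0 \<le> Theta11 / sqrt k" using Theta11_bounds(1) by simp
      ultimately show ?thesis using r by (simp add: inr flip: ennreal_mult)
    qed
    also have "\<dots> \<le> ennreal (1 / K)"
    proof (rule ennreal_leI)
      have "Theta11 / sqrt k / r \<le> 1 / 6624 / sqrt k / r"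
        using Theta11_bounds(2) r by (intro divide_right_mono) auto
      then show "Theta11 / sqrt k / r \<le> 1 / K" by (simp add: K_def)
    qed
    also have "\<dots> \<le> hausdorff1 (frontier E) / emeasure lborel E"
    \<comment> \<open>If the boundary has infinite length, the quotient is infinite because
      \<open>e\<close> is finite.\<close>
    proof (cases "hausdorff1 (frontier E)")
      case (real h)
      have "e \<le> K * h"
        using area real K by (simp add: e ennreal_mult[symmetric])
      then have "1 / K \<le> h / e" using K e_pos by (simp add: field_simps)
      then show ?thesis using real e_pos by (simp add: e divide_ennreal ennreal_leI)
    qed (simp add: e ennreal_top_divide)
    finally show "ennreal (Theta11 / sqrt (real k)) * (1 / inradius \<Omega>)
        \<le> hausdorff1 (frontier E) / emeasure lborel E" .
  qed
qed

end
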